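(* Let $\alpha_{\mathrm{OGP}}(\kappa)\triangleq 10\kappa^2\log_2\frac1\kappa$. For every sufficiently small $\kappa>0$ and every $\alpha$ with $\alpha_{\mathrm{OGP}}(\kappa)\le \alpha<\alpha_c(\kappa)$, there exist $0<\eta<\beta<1$, $c>0$ and $m\in\mathbb{N}$ such that the following holds: there are constants $c'>0$ and $n_0$ such that for all $n\ge n_0$ and every set $\mathcal{I}\subset[0,\pi/2]$ with $|\mathcal{I}|\le 2^{cn}$, \[ \mathbb{P}\bigl[\mathcal{S}_\kappa(\beta,\eta,m,\alpha,\mathcal{I})\neq\varnothing\bigr]\le 2^{-c'n}. \]
   Context: Let $\mathcal{B}_n=\{-1,1\}^n$. For $\kappa>0$ let $\alpha_c(\kappa)=-1/\log_2\mathbb{P}[|Z|\le\kappa]$ with $Z\sim\mathcal{N}(0,1)$. Given $\kappa>0$, $0<\alpha<\alpha_c(\kappa)$, $m\in\mathbb{N}$, $0<\eta<\beta<1$ and $\mathcal{I}\subset[0,\pi/2]$, set $M=\lfloor n\alpha\rfloor$, let $\mathcal{M}_0,\mathcal{M}_1,\dots,\mathcal{M}_m$ be i.i.d. $M\times n$ random matrices with i.i.d. $\mathcal{N}(0,1)$ entries, and for $\tau\in[0,\pi/2]$ let $\mathcal{M}_i(\tau)=\cos(\tau)\mathcal{M}_0+\sin(\tau)\mathcal{M}_i$. The random set $\mathcal{S}_\kappa(\beta,\eta,m,\alpha,\mathcal{I})$ consists of all $m$-tuples $(\sigma^{(1)},\dots,\sigma^{(m)})\in\mathcal{B}_n^m$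 such that (a) $\beta-\eta\le n^{-1}\langle\sigma^{(i)},\sigma^{(j)}\rangle\le\beta$ for all $1\le i<j\le m$, and (b) there exist $\tau_1,\dots,\tau_m\in\mathcal{I}$ with $\|\mathcal{M}_i(\tau_i)\sigma^{(i)}\|_\infty\le\kappa\sqrt n$ for all $1\le i\le m$. *)

theory Defs
  imports "HOL-Probability.Probability"
begin

definition std_gaussian :: "real measure" where
  "std_gaussian = density lborel (\<lambda>x. ennreal (std_normal_density x))"

definition alpha_c :: "real \<Rightarrow> real" where
  "alpha_c \<kappa> = - 1 / log 2 (measure std_gaussian {z. \<bar>z\<bar> \<le> \<kappa>})"

definition alpha_OGP :: "real \<Rightarrow> real" where
  "alpha_OGP \<kappa> = 10 * \<kappa>\<^sup>2 * log 2 (1 / \<kappa>)"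

definition num_rows :: "real \<Rightarrow> nat \<Rightarrow> nat" where
  "num_rows \<alpha> n = nat \<lfloor>real n * \<alpha>\<rfloor>"

text \<open>Vectors and matrices are functions on nat; only the entries below the respective
  dimensions matter. Elements of \<open>cube n\<close> are extensional, so that equality on \<open>cube n\<close> is
  equality of vectors.\<close>

definition cube :: "nat \<Rightarrow> (nat \<Rightarrow> real) set" where
  "cube n = {..<n} \<rightarrow>\<^sub>E {-1, 1}"

definition inner_prod :: "nat \<Rightarrow> (nat \<Rightarrow> real) \<Rightarrow> (nat \<Rightarrow> real) \<Rightarrow> real" where
  "inner_prod n x y = (\<Sum>j<n. x j * y j)"

definition mat_vec :: "nat \<Rightarrow> (nat \<Rightarrow> nat \<Rightarrow> real) \<Rightarrow> (nat \<Rightarrow> real) \<Rightarrow> nat \<Rightarrow> real" where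
  "mat_vec n A x = (\<lambda>r. \<Sum>j<n. A r j * x j)"

text \<open>The inserted 0 only matters for \<open>M = 0\<close>, where the norm of the empty vector is 0.\<close>

definition linf_norm :: "nat \<Rightarrow> (nat \<Rightarrow> real) \<Rightarrow> real" where
  "linf_norm M v = Max (insert 0 ((\<lambda>r. \<bar>v r\<bar>) ` {..<M}))"

text \<open>A sample \<open>\<omega>\<close> lists all entries of the \<open>m + 1\<close> independent matrices:
  \<open>\<omega> (i, r, j)\<close> is the entry in row \<open>r\<close> and column \<open>j\<close> of the \<open>i\<close>-th matrix,
  where \<open>i \<le> m\<close>, \<open>r < M\<close> and \<open>j < n\<close>.\<close>

type_synonym sample = "nat \<times> nat \<times> nat \<Rightarrow> real"

definition gaussian_matrices :: "nat \<Rightarrow> nat \<Rightarrow> nat \<Rightarrow> sample measure" where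
  "gaussian_matrices m M n = Pi\<^sub>M ({..m} \<times> {..<M} \<times> {..<n}) (\<lambda>_. std_gaussian)"

definition interp_matrix :: "sample \<Rightarrow> nat \<Rightarrow> real \<Rightarrow> nat \<Rightarrow> nat \<Rightarrow> real" where
  "interp_matrix \<omega> i \<tau> = (\<lambda>r j. cos \<tau> * \<omega> (0, r, j) + sin \<tau> * \<omega> (i, r, j))"

definition ogp_set ::
  "real \<Rightarrow> real \<Rightarrow> real \<Rightarrow> nat \<Rightarrow> real \<Rightarrow> real set \<Rightarrow> nat \<Rightarrow> sample \<Rightarrow> (nat \<Rightarrow> nat \<Rightarrow> real) set"
where
  "ogp_set \<kappa> \<beta> \<eta> m \<alpha> I n \<omega> =
    {\<sigma> \<in> {1..m} \<rightarrow>\<^sub>E cube n.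
      (\<forall>i j. 1 \<le> i \<and> i < j \<and> j \<le> m \<longrightarrow>
         \<beta> - \<eta> \<le> inner_prod n (\<sigma> i) (\<sigma> j) / real n \<and>
         inner_prod n (\<sigma> i) (\<sigma> j) / real n \<le> \<beta>) \<and>
      (\<exists>\<tau>. \<forall>i\<in>{1..m}. \<tau> i \<in> I \<and>
         linf_norm (num_rows \<alpha> n) (mat_vec n (interp_matrix \<omega> i (\<tau> i)) (\<sigma> i))
           \<le> \<kappa> * sqrt (real n))}"

lemma linf_norm_le_iff: "linf_norm M v \<le> b \<longleftrightarrow> 0 \<le> b \<and> (\<forall>r<M. \<bar>v r\<bar> \<le> b)"
  unfolding linf_norm_def by (subst Max_le_iff) auto

text \<open>For finite \<open>I\<close> the event that the set is nonempty is measurable, so its probability is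
  not a default value.\<close>

lemma ogp_set_nonempty_measurable:
  fixes \<kappa> \<beta> \<eta> \<alpha> :: real and I :: "real set" and m n :: nat
  assumes "finite I"
  defines "P \<equiv> gaussian_matrices m (num_rows \<alpha> n) n"
  shows "{\<omega> \<in> space P. ogp_set \<kappa> \<beta> \<eta> m \<alpha> I n \<omega> \<noteq> {}} \<in> sets P"
proof -
  let ?M = "num_rows \<alpha> n"
  define T where "T = {\<sigma> \<in> {1..m} \<rightarrow>\<^sub>E cube n.
      (\<forall>i j. 1 \<le> i \<and> i < j \<and> j \<le> m \<longrightarrow>
         \<beta> - \<eta> \<le> inner_prod n (\<sigma> i) (\<sigma> j) / real n \<and>
         inner_prod n (\<sigma> i) (\<sigma> j) / real n \<le> \<beta>)}"
  have fin: "finite T"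
    unfolding T_def cube_def by (intro finite_subset[OF Collect_restrict] finite_PiE) auto
  have entry: "(\<lambda>\<omega>. \<omega> (i, r, j)) \<in> borel_measurable P" if "i \<le> m" "r < ?M" "j < n" for i r j
  proof -
    have "(\<lambda>\<omega>. \<omega> (i, r, j)) \<in> measurable P std_gaussian"
      unfolding P_def gaussian_matrices_def
      using that by (intro measurable_component_singleton) auto
    then show ?thesis by (simp add: std_gaussian_def)
  qed
  have atom: "{\<omega> \<in> space P. linf_norm ?M (mat_vec n (interp_matrix \<omega> i t) (\<sigma> i)) \<le> b} \<in> sets P"
    if "i \<in> {1..m}" for i t \<sigma> b
  proof -
    have row: "(\<lambda>\<omega>. \<bar>\<Sum>j<n. (cos t * \<omega> (0, r, j) + sin t * \<omega> (i, r, j)) * \<sigma> i j\<bar>)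
        \<in> borel_measurable P" if "r < ?M" for r
      using that \<open>i \<in> {1..m}\<close>
      by (intro borel_measurable_abs borel_measurable_sum borel_measurable_times
          borel_measurable_add borel_measurable_const entry) auto
    have eq: "{\<omega> \<in> space P. linf_norm ?M (mat_vec n (interp_matrix \<omega> i t) (\<sigma> i)) \<le> b} =
        {\<omega> \<in> space P. 0 \<le> b \<and> (\<forall>r\<in>{..<?M}.
          \<bar>\<Sum>j<n. (cos t * \<omega> (0, r, j) + sin t * \<omega> (i, r, j)) * \<sigma> i j\<bar> \<le> b)}"
      by (auto simp: linf_norm_le_iff mat_vec_def interp_matrix_def)
    show ?thesis
      unfolding eq
      by (intro sets.sets_Collect_conj sets.sets_Collect_const sets.sets_Collect_finite_All
          borel_measurable_le row borel_measurable_const) auto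
  qed
  have eq: "{\<omega> \<in> space P. ogp_set \<kappa> \<beta> \<eta> m \<alpha> I n \<omega> \<noteq> {}} =
      {\<omega> \<in> space P. \<exists>\<sigma>\<in>T. \<forall>i\<in>{1..m}. \<exists>t\<in>I.
         linf_norm ?M (mat_vec n (interp_matrix \<omega> i t) (\<sigma> i)) \<le> \<kappa> * sqrt (real n)}"
  proof -
    have "ogp_set \<kappa> \<beta> \<eta> m \<alpha> I n \<omega> =
        {\<sigma> \<in> T. \<forall>i\<in>{1..m}. \<exists>t\<in>I.
          linf_norm ?M (mat_vec n (interp_matrix \<omega> i t) (\<sigma> i)) \<le> \<kappa> * sqrt (real n)}" for \<omega>
      unfolding ogp_set_def T_def Bex_def[of I] bchoice_iff by blast
    then show ?thesis by blast
  qed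
  show ?thesis
    unfolding eq
    by (intro sets.sets_Collect_finite_Ex sets.sets_Collect_finite_All fin assms atom) auto
qed

end

theory Submission
  imports Defs
begin

text \<open>First moment method. For a fixed tuple of vectors and fixed angles, the constraints say that
  \<open>m * M\<close> linear forms in the Gaussian entries are small. The independent matrices only help: since
  \<open>cos\<^sup>2 + sin\<^sup>2 = 1\<close>, the covariance of these forms is bounded below by \<open>n * (1 - \<beta> - m * \<eta>)\<close>
  times the identity, whatever the angles are. Instead of working with a joint density, the indicator
  of \<open>\<bar>y\<bar> \<le> 1\<close> is bounded by \<open>exp ((1 - y\<^sup>2) / 2)\<close>, whose Gaussian expectation is computed by
  linearising the square; with \<open>1 - \<beta>\<close> of order \<open>\<kappa>\<^sup>2\<close> the loss against the true probability
  is only a constant. The union bound over tuples and angles then closes for large \<open>m\<close>.\<close>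

section \<open>One-dimensional Gaussian integrals\<close>

lemma prob_space_std_gaussian: "prob_space std_gaussian"
  unfolding std_gaussian_def using prob_space_normal_density[of 1 0] by simp

lemma sets_std_gaussian [measurable_cong, simp]: "sets std_gaussian = sets borel"
  by (simp add: std_gaussian_def)

lemma space_std_gaussian [simp]: "space std_gaussian = UNIV"
  by (simp add: std_gaussian_def)

interpretation std_gaussian: prob_space std_gaussian
  by (rule prob_space_std_gaussian)

interpretation gaussian_product: product_sigma_finite "\<lambda>_ :: 'i. std_gaussian"
  by (rule product_sigma_finite.intro) (rule std_gaussian.sigma_finite_measure_axioms)

lemma integral_iexp_std_gaussian:
  "(\<integral>x. iexp (t * x) \<partial>std_gaussian) = complex_of_real (exp (- (t\<^sup>2) / 2))"
  using fun_cong[OF char_std_normal_distribution, of t]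
  by (simp add: char_def std_gaussian_def)

text \<open>Completing the Gaussian: the standard density times the exponential is
  \<open>\<sigma>\<close> times the centred normal density of variance \<open>1 / (1 + a)\<close>,
  and the latter integrates to 1.\<close>

lemma integral_exp_square_std_gaussian:
  fixes a :: real
  assumes "0 \<le> a"
  shows "(\<integral>x. exp (- (a * x\<^sup>2 / 2)) \<partial>std_gaussian) = 1 / sqrt (1 + a)"
proof -
  define \<sigma> where "\<sigma> = 1 / sqrt (1 + a)"
  have \<sigma>: "0 < \<sigma>" and \<sigma>2: "\<sigma>\<^sup>2 = 1 / (1 + a)"
    using assms by (auto simp: \<sigma>_def power_divide)
  have "(\<integral>x. exp (- (a * x\<^sup>2 / 2)) \<partial>std_gaussian) =
      (\<integral>x. std_normal_density x * exp (- (a * x\<^sup>2 / 2)) \<partial>lborel)"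
    unfolding std_gaussian_def by (subst integral_density) auto
  also have "\<dots> = (\<integral>x. \<sigma> * normal_density 0 \<sigma> x \<partial>lborel)"
  proof (intro Bochner_Integration.integral_cong refl)
    fix x :: real
    have "sqrt (2 * pi * \<sigma>\<^sup>2) = sqrt (2 * pi) * \<sigma>"
      using \<sigma> by (simp add: real_sqrt_mult)
    moreover have "exp (- x\<^sup>2 / 2) * exp (- (a * x\<^sup>2 / 2)) = exp (- x\<^sup>2 / (2 * \<sigma>\<^sup>2))"
      using assms by (simp add: \<sigma>2 field_simps flip: exp_add)
    ultimately show "std_normal_density x * exp (- (a * x\<^sup>2 / 2)) = \<sigma> * normal_density 0 \<sigma> x"
      using \<sigma> by (simp add: normal_density_def)
  qed
  also have "\<dots> = \<sigma>"
    using \<sigma> by simp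
  finally show ?thesis by (simp add: \<sigma>_def)
qed

section \<open>Linear forms in independent Gaussians and their small-ball probability\<close>

text \<open>By independence the characteristic function factors over the coordinates.\<close>

lemma integral_iexp_gaussian_product:
  fixes c :: "'i \<Rightarrow> real"
  assumes "finite K"
  shows "(\<integral>\<omega>. iexp (\<Sum>k\<in>K. c k * \<omega> k) \<partial>Pi\<^sub>M K (\<lambda>_. std_gaussian)) =
    complex_of_real (exp (- (\<Sum>k\<in>K. (c k)\<^sup>2) / 2))"
proof -
  have int: "integrable std_gaussian (\<lambda>x. iexp (c k * x))" for k
    by (rule std_gaussian.integrable_const_bound[where B = 1]) (auto simp: std_gaussian_def)
  have "(\<integral>\<omega>. iexp (\<Sum>k\<in>K. c k * \<omega> k) \<partial>Pi\<^sub>M K (\<lambda>_. std_gaussian)) =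
      (\<integral>\<omega>. (\<Prod>k\<in>K. iexp (c k * \<omega> k)) \<partial>Pi\<^sub>M K (\<lambda>_. std_gaussian))"
    using assms by (simp add: sum_distrib_left exp_sum)
  also have "\<dots> = (\<Prod>k\<in>K. \<integral>x. iexp (c k * x) \<partial>std_gaussian)"
    by (rule gaussian_product.product_integral_prod[OF assms int])
  also have "\<dots> = complex_of_real (exp (\<Sum>k\<in>K. - ((c k)\<^sup>2) / 2))"
    using assms by (simp only: integral_iexp_std_gaussian of_real_prod exp_sum)
  finally show ?thesis
    by (simp add: sum_negf sum_divide_distrib)
qed

text \<open>Hubbard--Stratonovich: each factor \<open>exp (- Y\<^sup>2 / 2)\<close> is the characteristic function of an
  auxiliary Gaussian at \<open>Y\<close>; exchanging the integrals turns the rows of \<open>A\<close> into columns.\<close>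

lemma gaussian_product_exp_transpose:
  fixes A :: "'l \<Rightarrow> 'k \<Rightarrow> real"
  assumes "finite K" "finite L"
  shows "(\<integral>\<omega>. exp (- (\<Sum>l\<in>L. (\<Sum>k\<in>K. A l k * \<omega> k)\<^sup>2) / 2) \<partial>Pi\<^sub>M K (\<lambda>_. std_gaussian)) =
    (\<integral>\<xi>. exp (- (\<Sum>k\<in>K. (\<Sum>l\<in>L. A l k * \<xi> l)\<^sup>2) / 2) \<partial>Pi\<^sub>M L (\<lambda>_. std_gaussian))"
proof -
  let ?K = "Pi\<^sub>M K (\<lambda>_. std_gaussian)" and ?L = "Pi\<^sub>M L (\<lambda>_. std_gaussian)"
  interpret K: prob_space ?K by (intro prob_space_PiM prob_space_std_gaussian)
  interpret L: prob_space ?L by (intro prob_space_PiM prob_space_std_gaussian)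
  interpret KL: pair_prob_space ?K ?L ..
  let ?f = "\<lambda>\<omega> \<xi>. iexp (\<Sum>l\<in>L. \<Sum>k\<in>K. A l k * \<omega> k * \<xi> l)"
  have meas: "(\<lambda>(\<omega>, \<xi>). ?f \<omega> \<xi>) \<in> borel_measurable (?K \<Otimes>\<^sub>M ?L)"
  proof -
    have "(\<lambda>p. \<Sum>l\<in>L. \<Sum>k\<in>K. A l k * fst p k * snd p l) \<in> borel_measurable (?K \<Otimes>\<^sub>M ?L)"
      by measurable
    then show ?thesis
      by (simp add: case_prod_beta)
  qed
  \<comment> \<open>The integrand has modulus 1 on a probability space, which is what Fubini needs
    below.\<close>
  have int: "integrable (?K \<Otimes>\<^sub>M ?L) (\<lambda>(\<omega>, \<xi>). ?f \<omega> \<xi>)"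
    by (rule KL.integrable_const_bound[where B = 1]) (use meas in \<open>auto simp: case_prod_beta\<close>)
  have "complex_of_real (\<integral>\<omega>. exp (- (\<Sum>l\<in>L. (\<Sum>k\<in>K. A l k * \<omega> k)\<^sup>2) / 2) \<partial>?K) =
      (\<integral>\<omega>. complex_of_real (exp (- (\<Sum>l\<in>L. (\<Sum>k\<in>K. A l k * \<omega> k)\<^sup>2) / 2)) \<partial>?K)"
    by simp
  also have "\<dots> = (\<integral>\<omega>. (\<integral>\<xi>. ?f \<omega> \<xi> \<partial>?L) \<partial>?K)"
    by (simp only: integral_iexp_gaussian_product[OF assms(2), symmetric] sum_distrib_right)
  also have "\<dots> = (\<integral>\<xi>. (\<integral>\<omega>. ?f \<omega> \<xi> \<partial>?K) \<partial>?L)"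
    by (rule KL.Fubini_integral[OF int, symmetric])
  also have "\<dots> = (\<integral>\<xi>. (\<integral>\<omega>. iexp (\<Sum>k\<in>K. (\<Sum>l\<in>L. A l k * \<xi> l) * \<omega> k) \<partial>?K) \<partial>?L)"
  proof -
    have "(\<Sum>l\<in>L. \<Sum>k\<in>K. A l k * \<omega> k * \<xi> l) = (\<Sum>k\<in>K. (\<Sum>l\<in>L. A l k * \<xi> l) * \<omega> k)"
      for \<omega> :: "'k \<Rightarrow> real" and \<xi> :: "'l \<Rightarrow> real"
      unfolding sum_distrib_right by (subst sum.swap) (simp only: mult_ac)
    then show ?thesis by simp
  qed
  also have "\<dots> = (\<integral>\<xi>. complex_of_real (exp (- (\<Sum>k\<in>K. (\<Sum>l\<in>L. A l k * \<xi> l)\<^sup>2) / 2)) \<partial>?L)"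
    by (simp only: integral_iexp_gaussian_product[OF assms(1)])
  also have "\<dots> = complex_of_real (\<integral>\<xi>. exp (- (\<Sum>k\<in>K. (\<Sum>l\<in>L. A l k * \<xi> l)\<^sup>2) / 2) \<partial>?L)"
    by simp
  finally show ?thesis
    by (simp only: of_real_eq_iff)
qed

text \<open>Each form, divided by \<open>b\<close>, pays a factor \<open>exp (1 / 2)\<close> for
  replacing its indicator by a Gaussian weight. After transposition the exponent is the quadratic
  form of the covariance matrix, so coercivity dominates the integrand by a product of
  one-dimensional weights with parameter \<open>\<Lambda> / b\<^sup>2\<close>. No determinant has to
  be computed, and degenerate covariances (\<open>\<Lambda> = 0\<close>) are allowed.\<close>

lemma gaussian_small_ball:
  fixes A :: "'l \<Rightarrow> 'k \<Rightarrow> real"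
  assumes "finite K" "finite L" and "0 \<le> \<Lambda>" "0 < b"
    and coercive: "\<And>\<xi>. \<Lambda> * (\<Sum>l\<in>L. (\<xi> l)\<^sup>2) \<le> (\<Sum>k\<in>K. (\<Sum>l\<in>L. A l k * \<xi> l)\<^sup>2)"
  shows "measure (Pi\<^sub>M K (\<lambda>_. std_gaussian))
      {\<omega> \<in> space (Pi\<^sub>M K (\<lambda>_. std_gaussian)). \<forall>l\<in>L. \<bar>\<Sum>k\<in>K. A l k * \<omega> k\<bar> \<le> b}
    \<le> sqrt (exp 1 / (1 + \<Lambda> / b\<^sup>2)) ^ card L"
proof -
  let ?K = "Pi\<^sub>M K (\<lambda>_. std_gaussian)" and ?L = "Pi\<^sub>M L (\<lambda>_. std_gaussian)"
  interpret K: prob_space ?K by (intro prob_space_PiM prob_space_std_gaussian)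
  interpret L: prob_space ?L by (intro prob_space_PiM prob_space_std_gaussian)
  let ?E = "{\<omega> \<in> space ?K. \<forall>l\<in>L. \<bar>\<Sum>k\<in>K. A l k * \<omega> k\<bar> \<le> b}"
  let ?g = "\<lambda>\<omega>. exp (- (\<Sum>l\<in>L. (\<Sum>k\<in>K. (A l k / b) * \<omega> k)\<^sup>2) / 2)"
  have [measurable]: "?E \<in> sets ?K"
    using assms(2) by measurable
  have int_g: "integrable ?K ?g"
    by (rule K.integrable_const_bound[where B = 1]) (auto intro!: sum_nonneg)
  have int_E: "integrable ?K (indicator ?E :: _ \<Rightarrow> real)"
    by (rule K.integrable_const_bound[where B = 1]) (auto simp: indicator_def)
  have "measure ?K ?E = (\<integral>\<omega>. indicator ?E \<omega> \<partial>?K)"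
    by simp
  also have "\<dots> \<le> (\<integral>\<omega>. exp (card L / 2) * ?g \<omega> \<partial>?K)"
  proof (rule integral_mono)
    fix \<omega> assume "\<omega> \<in> space ?K"
    show "indicator ?E \<omega> \<le> exp (card L / 2) * ?g \<omega>"
    proof (cases "\<omega> \<in> ?E")
      case True
      have "(\<Sum>l\<in>L. (\<Sum>k\<in>K. (A l k / b) * \<omega> k)\<^sup>2) \<le> (\<Sum>l\<in>L. 1)"
      proof (rule sum_mono)
        fix l assume "l \<in> L"
        then have "\<bar>\<Sum>k\<in>K. A l k * \<omega> k\<bar> / b \<le> 1"
          using True \<open>0 < b\<close> by (simp add: divide_le_eq)
        then have "\<bar>\<Sum>k\<in>K. (A l k / b) * \<omega> k\<bar> \<le> 1"
          using \<open>0 < b\<close> by (simp flip: sum_divide_distrib)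
        then show "(\<Sum>k\<in>K. (A l k / b) * \<omega> k)\<^sup>2 \<le> 1"
          by (simp add: abs_square_le_1)
      qed
      then have "1 \<le> exp (card L / 2 + - (\<Sum>l\<in>L. (\<Sum>k\<in>K. (A l k / b) * \<omega> k)\<^sup>2) / 2)"
        by simp
      then show ?thesis
        using True by (simp only: exp_add indicator_simps)
    qed auto
  qed (use int_g int_E in auto)
  also have "\<dots> = exp (card L / 2) *
      (\<integral>\<xi>. exp (- (\<Sum>k\<in>K. (\<Sum>l\<in>L. (A l k / b) * \<xi> l)\<^sup>2) / 2) \<partial>?L)"
    using gaussian_product_exp_transpose[OF assms(1,2), of "\<lambda>l k. A l k / b"] by simp
  also have "\<dots> \<le> exp (card L / 2) *
      (\<integral>\<xi>. (\<Prod>l\<in>L. exp (- (\<Lambda> / b\<^sup>2 * (\<xi> l)\<^sup>2 / 2))) \<partial>?L)"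
  proof (intro mult_left_mono integral_mono)
    have prod: "(\<Prod>l\<in>L. exp (- (\<Lambda> / b\<^sup>2 * (\<xi> l)\<^sup>2 / 2))) = exp (- (\<Lambda> * (\<Sum>l\<in>L. (\<xi> l)\<^sup>2)) / b\<^sup>2 / 2)"
      for \<xi> :: "'l \<Rightarrow> real"
      using assms(2)
      by (simp add: exp_sum[symmetric] sum_negf sum_distrib_left sum_divide_distrib)
    fix \<xi> :: "'l \<Rightarrow> real"
    have "(\<Sum>k\<in>K. (\<Sum>l\<in>L. (A l k / b) * \<xi> l)\<^sup>2) = (\<Sum>k\<in>K. (\<Sum>l\<in>L. A l k * \<xi> l)\<^sup>2) / b\<^sup>2"
      by (simp add: sum_divide_distrib[symmetric] power_divide)
    then have "\<Lambda> * (\<Sum>l\<in>L. (\<xi> l)\<^sup>2) / b\<^sup>2 \<le> (\<Sum>k\<in>K. (\<Sum>l\<in>L. (A l k / b) * \<xi> l)\<^sup>2)"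
      using divide_right_mono[OF coercive[of \<xi>], of "b\<^sup>2"] by simp
    then show "exp (- (\<Sum>k\<in>K. (\<Sum>l\<in>L. (A l k / b) * \<xi> l)\<^sup>2) / 2)
        \<le> (\<Prod>l\<in>L. exp (- (\<Lambda> / b\<^sup>2 * (\<xi> l)\<^sup>2 / 2)))"
      unfolding prod by simp
  next
    show "integrable ?L (\<lambda>\<xi>. exp (- (\<Sum>k\<in>K. (\<Sum>l\<in>L. (A l k / b) * \<xi> l)\<^sup>2) / 2))"
      by (rule L.integrable_const_bound[where B = 1]) (auto intro!: sum_nonneg)
    show "integrable ?L (\<lambda>\<xi>. \<Prod>l\<in>L. exp (- (\<Lambda> / b\<^sup>2 * (\<xi> l)\<^sup>2 / 2)))"
      by (rule L.integrable_const_bound[where B = 1])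
        (use assms in \<open>auto intro!: prod_le_1 simp: abs_prod\<close>)
  qed auto
  also have "\<dots> = exp (card L / 2) * (1 / sqrt (1 + \<Lambda> / b\<^sup>2)) ^ card L"
  proof -
    have "integrable std_gaussian (\<lambda>x. exp (- (\<Lambda> / b\<^sup>2 * x\<^sup>2 / 2)))"
      by (rule std_gaussian.integrable_const_bound[where B = 1])
        (use assms in \<open>auto simp: std_gaussian_def\<close>)
    then show ?thesis
      using assms
      by (subst gaussian_product.product_integral_prod)
        (auto simp: integral_exp_square_std_gaussian[of "\<Lambda> / b\<^sup>2", simplified])
  qed
  also have "\<dots> = sqrt (exp 1 / (1 + \<Lambda> / b\<^sup>2)) ^ card L"
  proof -
    have "sqrt (exp 1) = exp (1 / 2 :: real)"
      by (rule real_sqrt_unique) (auto simp: power2_eq_square simp flip: exp_add)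
    then have "exp (card L / 2) = sqrt (exp 1) ^ card L"
      by (simp flip: exp_of_nat_mult)
    then show ?thesis
      by (simp add: real_sqrt_divide power_divide)
  qed
  finally show ?thesis .
qed

section \<open>Lower bound for a nearly equicorrelated Gram matrix\<close>

text \<open>The Gram matrix is \<open>N\<close> times the sum of \<open>1 - \<beta>\<close> times
  the identity, \<open>\<beta>\<close> times the all-ones matrix, and an error with entries at most
  \<open>\<eta>\<close>. The all-ones part is positive semidefinite, and by Cauchy-Schwarz the error
  costs at most \<open>card I * \<eta>\<close> in the quadratic form.\<close>

lemma sum_squares_nearly_equicorrelated:
  fixes v :: "'i \<Rightarrow> 'j \<Rightarrow> real" and a :: "'i \<Rightarrow> real" and N \<beta> \<eta> :: real
  assumes "finite I" "0 \<le> N" "0 \<le> \<beta>" "0 \<le> \<eta>"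
    and diag: "\<And>i. i \<in> I \<Longrightarrow> (\<Sum>j\<in>J. v i j * v i j) = N"
    and off: "\<And>i k. i \<in> I \<Longrightarrow> k \<in> I \<Longrightarrow> i \<noteq> k \<Longrightarrow> \<bar>(\<Sum>j\<in>J. v i j * v k j) - N * \<beta>\<bar> \<le> N * \<eta>"
  shows "N * (1 - \<beta> - card I * \<eta>) * (\<Sum>i\<in>I. (a i)\<^sup>2) \<le> (\<Sum>j\<in>J. (\<Sum>i\<in>I. a i * v i j)\<^sup>2)"
proof -
  let ?G = "\<lambda>i k. \<Sum>j\<in>J. v i j * v k j"
  let ?S = "\<Sum>i\<in>I. (a i)\<^sup>2"
  \<comment> \<open>The error is charged on the diagonal as well, so that its sum over all pairs is
    exactly \<open>\<eta>\<close> times the square of the sum of the absolute values.\<close>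
  have entry: "N * (\<beta> * (a i * a k) + (if i = k then (1 - \<beta>) * (a i)\<^sup>2 else 0) - \<eta> * (\<bar>a i\<bar> * \<bar>a k\<bar>))
      \<le> a i * a k * ?G i k" if "i \<in> I" "k \<in> I" for i k
  proof (cases "i = k")
    case True
    have "0 \<le> N * (\<eta> * (a i)\<^sup>2)"
      using assms by simp
    then show ?thesis
      using True diag[OF that(1)] by (simp add: power2_eq_square algebra_simps)
  next
    case False
    have "\<bar>a i * a k * (?G i k - N * \<beta>)\<bar> \<le> \<bar>a i * a k\<bar> * (N * \<eta>)"
      using mult_left_mono[OF off[OF that False] abs_ge_zero[of "a i * a k"]] by (simp add: abs_mult)
    then show ?thesis
      using False by (simp add: abs_mult algebra_simps)
  qed
  have "(\<Sum>i\<in>I. \<bar>a i\<bar>)\<^sup>2 \<le> card I * ?S"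
    using sum_squared_le_sum_of_squares[of "\<lambda>i. \<bar>a i\<bar>" I] by (simp add: mult.commute)
  then have "\<eta> * (\<Sum>i\<in>I. \<bar>a i\<bar>)\<^sup>2 \<le> \<eta> * (card I * ?S)"
    using assms by (intro mult_left_mono) auto
  moreover have "0 \<le> \<beta> * (\<Sum>i\<in>I. a i)\<^sup>2"
    using assms by simp
  ultimately have "(1 - \<beta> - card I * \<eta>) * ?S
      \<le> \<beta> * (\<Sum>i\<in>I. a i)\<^sup>2 + (1 - \<beta>) * ?S - \<eta> * (\<Sum>i\<in>I. \<bar>a i\<bar>)\<^sup>2"
    by (simp add: algebra_simps)
  then have "N * (1 - \<beta> - card I * \<eta>) * ?S
      \<le> N * (\<beta> * (\<Sum>i\<in>I. a i)\<^sup>2 + (1 - \<beta>) * ?S - \<eta> * (\<Sum>i\<in>I. \<bar>a i\<bar>)\<^sup>2)"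
    using mult_left_mono[OF _ \<open>0 \<le> N\<close>] by (simp add: mult.assoc)
  also have "\<dots> = (\<Sum>i\<in>I. \<Sum>k\<in>I.
      N * (\<beta> * (a i * a k) + (if i = k then (1 - \<beta>) * (a i)\<^sup>2 else 0) - \<eta> * (\<bar>a i\<bar> * \<bar>a k\<bar>)))"
  proof -
    have "(\<Sum>i\<in>I. a i)\<^sup>2 = (\<Sum>i\<in>I. \<Sum>k\<in>I. a i * a k)"
      and "(\<Sum>i\<in>I. \<bar>a i\<bar>)\<^sup>2 = (\<Sum>i\<in>I. \<Sum>k\<in>I. \<bar>a i\<bar> * \<bar>a k\<bar>)"
      by (simp_all only: power2_eq_square sum_product)
    moreover have "(1 - \<beta>) * ?S = (\<Sum>i\<in>I. \<Sum>k\<in>I. if i = k then (1 - \<beta>) * (a i)\<^sup>2 else 0)"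
      using assms(1) by (simp add: sum_distrib_left)
    ultimately have "\<beta> * (\<Sum>i\<in>I. a i)\<^sup>2 + (1 - \<beta>) * ?S - \<eta> * (\<Sum>i\<in>I. \<bar>a i\<bar>)\<^sup>2 = (\<Sum>i\<in>I. \<Sum>k\<in>I.
        \<beta> * (a i * a k) + (if i = k then (1 - \<beta>) * (a i)\<^sup>2 else 0) - \<eta> * (\<bar>a i\<bar> * \<bar>a k\<bar>))"
      by (simp only: sum_distrib_left sum.distrib sum_subtractf)
    then show ?thesis
      by (simp only: sum_distrib_left)
  qed
  also have "\<dots> \<le> (\<Sum>i\<in>I. \<Sum>k\<in>I. a i * a k * ?G i k)"
    by (intro sum_mono entry)
  also have "\<dots> = (\<Sum>i\<in>I. \<Sum>k\<in>I. \<Sum>j\<in>J. (a i * v i j) * (a k * v k j))"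
    by (simp only: sum_distrib_left mult_ac)
  also have "\<dots> = (\<Sum>j\<in>J. \<Sum>i\<in>I. \<Sum>k\<in>I. (a i * v i j) * (a k * v k j))"
    by (simp only: sum.swap[of _ J])
  also have "\<dots> = (\<Sum>j\<in>J. (\<Sum>i\<in>I. a i * v i j)\<^sup>2)"
    by (simp only: power2_eq_square sum_product)
  finally show ?thesis .
qed

section \<open>Counting tuples of cube vectors with prescribed overlaps\<close>

lemma cube_entry: "x \<in> cube n \<Longrightarrow> j < n \<Longrightarrow> x j \<in> {-1, 1}"
  by (auto simp: cube_def PiE_iff)

lemma cube_square: "x \<in> cube n \<Longrightarrow> j < n \<Longrightarrow> x j * x j = 1"
  using cube_entry[of x n j] by auto

lemma finite_cube [simp]: "finite (cube n)"
  unfolding cube_def by (intro finite_PiE) auto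

lemma card_cube: "card (cube n) = 2 ^ n"
  unfolding cube_def by (subst card_PiE) (auto simp: numeral_2_eq_2)

text \<open>Chernoff bound, with \<open>cosh t \<le> exp (t + exp (- 2 * t)) / 2\<close>.\<close>

lemma card_cube_inner_prod_ge:
  assumes x: "x \<in> cube n" and "0 \<le> t"
  shows "real (card {y \<in> cube n. q * real n \<le> inner_prod n x y})
    \<le> exp (real n * (t * (1 - q) + exp (- 2 * t)))"
proof -
  let ?B = "{y \<in> cube n. q * real n \<le> inner_prod n x y}"
  have pair: "exp (t * s) + exp (- (t * s)) \<le> exp (t + exp (- 2 * t))" if "s \<in> {-1, 1}" for s :: real
  proof -
    have "exp (t * s) + exp (- (t * s)) = exp t * (1 + exp (- 2 * t))"
      using that by (auto simp: algebra_simps simp flip: exp_add)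
    also have "\<dots> \<le> exp t * exp (exp (- 2 * t))"
      by (intro mult_left_mono exp_ge_add_one_self) auto
    finally show ?thesis
      by (simp add: exp_add)
  qed
  have "real (card ?B) = (\<Sum>y\<in>?B. 1)"
    by simp
  also have "\<dots> \<le> (\<Sum>y\<in>?B. exp (t * (inner_prod n x y - q * real n)))"
    using \<open>0 \<le> t\<close> by (intro sum_mono) auto
  \<comment> \<open>Extending the sum from \<open>?B\<close> to the whole cube makes it factor over
    the coordinates.\<close>
  also have "\<dots> \<le> (\<Sum>y\<in>cube n. exp (t * (inner_prod n x y - q * real n)))"
    by (intro sum_mono2) auto
  also have "\<dots> = (\<Sum>y\<in>cube n. exp (- (t * q * real n)) * (\<Prod>j<n. exp (t * (x j * y j))))"
  proof (intro sum.cong refl)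
    fix y
    have "t * (inner_prod n x y - q * real n) = - (t * q * real n) + (\<Sum>j<n. t * (x j * y j))"
      by (simp add: inner_prod_def right_diff_distrib sum_distrib_left)
    then show "exp (t * (inner_prod n x y - q * real n)) =
        exp (- (t * q * real n)) * (\<Prod>j<n. exp (t * (x j * y j)))"
      by (simp only: exp_add exp_sum finite_lessThan)
  qed
  also have "\<dots> = exp (- (t * q * real n)) * (\<Prod>j<n. \<Sum>s\<in>{-1, 1}. exp (t * (x j * s)))"
    unfolding cube_def sum_distrib_left[symmetric] by (subst prod_sum_PiE) auto
  also have "\<dots> \<le> exp (- (t * q * real n)) * (\<Prod>j<n. exp (t + exp (- 2 * t)))"
  proof (intro mult_left_mono prod_mono conjI)
    fix j assume "j \<in> {..<n}"
    then have "x j \<in> {-1, 1}"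
      using cube_entry[OF x] by simp
    then show "(\<Sum>s\<in>{-1, 1}. exp (t * (x j * s))) \<le> exp (t + exp (- 2 * t))"
      using pair[of "x j"] by (simp add: add.commute)
  qed (auto intro: sum_nonneg)
  also have "\<dots> = exp (real n * (t * (1 - q) + exp (- 2 * t)))"
    by (simp add: exp_of_nat_mult[symmetric] exp_add[symmetric] algebra_simps)
  finally show ?thesis .
qed

text \<open>The deterministic condition in \<open>ogp_set\<close>, split off so that the union bound
  runs over a set independent of the sample.\<close>

definition overlap_tuples :: "nat \<Rightarrow> nat \<Rightarrow> real \<Rightarrow> real \<Rightarrow> (nat \<Rightarrow> nat \<Rightarrow> real) set" where
  "overlap_tuples n m \<beta> \<eta> = {\<sigma> \<in> {1..m} \<rightarrow>\<^sub>E cube n. \<forall>i j. 1 \<le> i \<and> i < j \<and> j \<le> m \<longrightarrow>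
     \<beta> - \<eta> \<le> inner_prod n (\<sigma> i) (\<sigma> j) / real n \<and> inner_prod n (\<sigma> i) (\<sigma> j) / real n \<le> \<beta>}"

lemma finite_overlap_tuples [simp]: "finite (overlap_tuples n m \<beta> \<eta>)"
  unfolding overlap_tuples_def
  by (rule finite_subset[OF Collect_restrict]) (intro finite_PiE, auto)

text \<open>The first vector is free, giving \<open>2 ^ n\<close>; every other vector lies in the
  cap of overlap at least \<open>\<beta> - \<eta>\<close> around it, whose size the Chernoff bound
  controls.\<close>

lemma card_overlap_tuples:
  assumes "0 < n" "1 \<le> m" "0 \<le> t" "\<beta> - \<eta> \<le> 1"
  shows "real (card (overlap_tuples n m \<beta> \<eta>))
    \<le> 2 ^ n * exp (real n * (t * (1 - \<beta> + \<eta>) + exp (- 2 * t))) ^ m"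
proof -
  define C where "C = exp (real n * (t * (1 - \<beta> + \<eta>) + exp (- 2 * t)))"
  define B where "B x = {y \<in> cube n. (\<beta> - \<eta>) * real n \<le> inner_prod n x y}" for x
  let ?P = "\<lambda>x. Pi\<^sub>E {1..m} (\<lambda>i. if i = 1 then {x} else B x)"
  \<comment> \<open>This lets \<open>C ^ m\<close> replace \<open>C ^ (m - 1)\<close>: the singleton
    factor at \<open>i = 1\<close> is also bounded by \<open>C\<close>.\<close>
  have C: "1 \<le> C"
    using assms by (simp add: C_def)
  have finB: "finite (B x)" for x
    by (simp add: B_def)
  have cardB: "real (card (B x)) \<le> C" if "x \<in> cube n" for x
    using card_cube_inner_prod_ge[OF that \<open>0 \<le> t\<close>, of "\<beta> - \<eta>"] by (simp add: B_def C_def algebra_simps)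
  have "overlap_tuples n m \<beta> \<eta> \<subseteq> (\<Union>x\<in>cube n. ?P x)"
  proof
    fix \<sigma> assume \<sigma>: "\<sigma> \<in> overlap_tuples n m \<beta> \<eta>"
    have mem: "\<sigma> i \<in> cube n" if "i \<in> {1..m}" for i
      using \<sigma> that by (auto simp: overlap_tuples_def PiE_iff)
    have "\<sigma> i \<in> B (\<sigma> 1)" if "i \<in> {1..m}" "i \<noteq> 1" for i
    proof -
      have "\<beta> - \<eta> \<le> inner_prod n (\<sigma> 1) (\<sigma> i) / real n"
        using \<sigma> that by (auto simp: overlap_tuples_def)
      then show ?thesis
        using mem[OF that(1)] \<open>0 < n\<close> by (simp add: B_def le_divide_eq)
    qed
    then have "\<sigma> \<in> ?P (\<sigma> 1)"
      using \<sigma> by (auto simp: overlap_tuples_def PiE_iff)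
    then show "\<sigma> \<in> (\<Union>x\<in>cube n. ?P x)"
      using mem[of 1] assms(2) by auto
  qed
  then have "card (overlap_tuples n m \<beta> \<eta>) \<le> card (\<Union>x\<in>cube n. ?P x)"
    by (intro card_mono finite_UN_I finite_PiE) (auto simp: finB)
  also have "\<dots> \<le> (\<Sum>x\<in>cube n. card (?P x))"
    by (rule card_UN_le) simp
  finally have "real (card (overlap_tuples n m \<beta> \<eta>)) \<le> (\<Sum>x\<in>cube n. real (card (?P x)))"
    by (simp flip: of_nat_sum)
  also have "\<dots> \<le> (\<Sum>x\<in>cube n. C ^ m)"
  proof (rule sum_mono)
    fix x assume "x \<in> cube n"
    then have "(\<Prod>i\<in>{1..m}. real (card (if i = 1 then {x} else B x))) \<le> (\<Prod>i\<in>{1..m}. C)"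
      using cardB C by (intro prod_mono) auto
    then show "real (card (?P x)) \<le> C ^ m"
      by (simp add: card_PiE)
  qed
  also have "\<dots> = 2 ^ n * C ^ m"
    by (simp add: card_cube)
  finally show ?thesis
    by (simp add: C_def)
qed

section \<open>Probability of the constraints for fixed vectors and angles, and the union
  bound\<close>

text \<open>An instance of \<open>gaussian_small_ball\<close> with forms indexed by a vector
  \<open>i\<close> and a row \<open>r\<close>. The work is coercivity: the shared matrix 0 sees the
  overlaps between vectors, weighted by cosines, while each matrix \<open>i \<ge> 1\<close> enters
  the constraints of one vector only, weighted by a sine.\<close>

lemma measure_tuple_le:
  fixes \<sigma> :: "nat \<Rightarrow> nat \<Rightarrow> real" and \<tau> :: "nat \<Rightarrow> real"
  assumes \<sigma>: "\<sigma> \<in> overlap_tuples n m \<beta> \<eta>"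
    and "0 < n" "0 < \<kappa>" "0 \<le> \<beta>" "0 \<le> \<eta>" "0 \<le> 1 - \<beta> - m * \<eta>"
  shows "measure (gaussian_matrices m M n) {\<omega> \<in> space (gaussian_matrices m M n).
      \<forall>i\<in>{1..m}. linf_norm M (mat_vec n (interp_matrix \<omega> i (\<tau> i)) (\<sigma> i)) \<le> \<kappa> * sqrt n}
    \<le> sqrt (exp 1 / (1 + (1 - \<beta> - m * \<eta>) / \<kappa>\<^sup>2)) ^ (m * M)"
proof -
  define \<gamma> where "\<gamma> = 1 - \<beta> - m * \<eta>"
  \<comment> \<open>\<open>B i i'\<close> is the weight of the \<open>i'\<close>-th Gaussian matrix
    in the \<open>i\<close>-th interpolated matrix, and \<open>A\<close> is the resulting
    coefficient array of all the forms.\<close>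
  define B where "B i i' = (if i' = 0 then cos (\<tau> i) else if i' = i then sin (\<tau> i) else 0)" for i i' :: nat
  define A :: "nat \<times> nat \<Rightarrow> nat \<times> nat \<times> nat \<Rightarrow> real"
    where "A = (\<lambda>(i, r) (i', r', j). if r' = r then B i i' * \<sigma> i j else 0)"
  let ?K = "{..m} \<times> {..<M} \<times> {..<n}" and ?L = "{1..m} \<times> {..<M}"
  have atMost: "{..m} = insert 0 {1..m}"
    by auto
  have cube: "\<sigma> i \<in> cube n" if "i \<in> {1..m}" for i
    using \<sigma> that by (auto simp: overlap_tuples_def PiE_iff)
  have sum_sq: "(\<Sum>j<n. \<sigma> i j * \<sigma> i j) = n" if "i \<in> {1..m}" for i
    using cube_square[OF cube[OF that]] by simp
  have overlap: "\<bar>(\<Sum>j<n. \<sigma> i j * \<sigma> k j) - n * \<beta>\<bar> \<le> n * \<eta>"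
    if "i \<in> {1..m}" "k \<in> {1..m}" "i \<noteq> k" for i k
  proof -
    have "\<beta> - \<eta> \<le> inner_prod n (\<sigma> i) (\<sigma> k) / n \<and> inner_prod n (\<sigma> i) (\<sigma> k) / n \<le> \<beta>"
      if "1 \<le> i" "i < k" "k \<le> m" for i k
      using \<sigma> that by (auto simp: overlap_tuples_def)
    from this[of i k] this[of k i] that
    have "\<beta> - \<eta> \<le> inner_prod n (\<sigma> i) (\<sigma> k) / n" "inner_prod n (\<sigma> i) (\<sigma> k) / n \<le> \<beta>"
      by (cases "i < k"; simp add: inner_prod_def mult.commute)+
    then have "n * \<beta> - n * \<eta> \<le> inner_prod n (\<sigma> i) (\<sigma> k)" "inner_prod n (\<sigma> i) (\<sigma> k) \<le> n * \<beta>"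
      using \<open>0 < n\<close> by (simp_all add: field_simps)
    moreover have "0 \<le> n * \<eta>"
      using assms by simp
    ultimately show ?thesis
      by (simp add: inner_prod_def)
  qed
  have row: "(\<Sum>k\<in>?K. A (i, r) k * \<omega> k) = mat_vec n (interp_matrix \<omega> i (\<tau> i)) (\<sigma> i) r"
    if "i \<in> {1..m}" "r < M" for i r \<omega>
  proof -
    have "(\<Sum>k\<in>?K. A (i, r) k * \<omega> k) =
        (\<Sum>i'\<le>m. \<Sum>r'<M. if r' = r then B i i' * (\<Sum>j<n. \<sigma> i j * \<omega> (i', r', j)) else 0)"
      unfolding sum.cartesian_product'
    proof (intro sum.cong refl)
      fix i' r'
      show "(\<Sum>j<n. A (i, r) (i', r', j) * \<omega> (i', r', j)) =
          (if r' = r then B i i' * (\<Sum>j<n. \<sigma> i j * \<omega> (i', r', j)) else 0)"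
        by (cases "r' = r") (simp_all add: A_def sum_distrib_left mult.assoc)
    qed
    also have "\<dots> = (\<Sum>i'\<le>m. B i i' * (\<Sum>j<n. \<sigma> i j * \<omega> (i', r, j)))"
      using that by simp
    also have "\<dots> = cos (\<tau> i) * (\<Sum>j<n. \<sigma> i j * \<omega> (0, r, j)) +
        (\<Sum>i'\<in>{1..m}. if i' = i then sin (\<tau> i) * (\<Sum>j<n. \<sigma> i j * \<omega> (i', r, j)) else 0)"
    proof -
      have "(\<Sum>i'\<in>{1..m}. B i i' * (\<Sum>j<n. \<sigma> i j * \<omega> (i', r, j))) =
          (\<Sum>i'\<in>{1..m}. if i' = i then sin (\<tau> i) * (\<Sum>j<n. \<sigma> i j * \<omega> (i', r, j)) else 0)"
        by (intro sum.cong refl) (auto simp: B_def)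
      then show ?thesis
        unfolding atMost by (subst sum.insert) (auto simp: B_def)
    qed
    also have "\<dots> = cos (\<tau> i) * (\<Sum>j<n. \<sigma> i j * \<omega> (0, r, j)) +
        sin (\<tau> i) * (\<Sum>j<n. \<sigma> i j * \<omega> (i, r, j))"
      using that by simp
    also have "\<dots> = mat_vec n (interp_matrix \<omega> i (\<tau> i)) (\<sigma> i) r"
      by (simp add: mat_vec_def interp_matrix_def sum_distrib_left sum.distrib algebra_simps)
    finally show ?thesis .
  qed
  have coercive: "n * \<gamma> * (\<Sum>l\<in>?L. (\<xi> l)\<^sup>2) \<le> (\<Sum>k\<in>?K. (\<Sum>l\<in>?L. A l k * \<xi> l)\<^sup>2)" for \<xi>
  proof -
    have entry: "(\<Sum>l\<in>?L. A l (i', r, j) * \<xi> l) = (\<Sum>i\<in>{1..m}. B i i' * \<xi> (i, r) * \<sigma> i j)"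
      if "r < M" for i' r j
    proof -
      have "(\<Sum>l\<in>?L. A l (i', r, j) * \<xi> l) =
          (\<Sum>i\<in>{1..m}. \<Sum>r'<M. if r' = r then B i i' * \<xi> (i, r) * \<sigma> i j else 0)"
        unfolding sum.cartesian_product' by (intro sum.cong refl) (auto simp: A_def)
      then show ?thesis
        using that by simp
    qed
    \<comment> \<open>Forms of different rows use disjoint sets of entries, so the quadratic form
      splits over \<open>r\<close> and each slice can be bounded alone.\<close>
    have slice: "n * \<gamma> * (\<Sum>i\<in>{1..m}. (\<xi> (i, r))\<^sup>2)
        \<le> (\<Sum>i'\<le>m. \<Sum>j<n. (\<Sum>i\<in>{1..m}. B i i' * \<xi> (i, r) * \<sigma> i j)\<^sup>2)" for r
    proof -
      have "n * \<gamma> * (\<Sum>i\<in>{1..m}. (cos (\<tau> i) * \<xi> (i, r))\<^sup>2)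
          \<le> (\<Sum>j<n. (\<Sum>i\<in>{1..m}. cos (\<tau> i) * \<xi> (i, r) * \<sigma> i j)\<^sup>2)"
        using sum_squares_nearly_equicorrelated[where I = "{1..m}" and J = "{..<n}" and v = \<sigma>
            and N = n and \<beta> = \<beta> and \<eta> = \<eta> and a = "\<lambda>i. cos (\<tau> i) * \<xi> (i, r)"]
          assms sum_sq overlap by (simp add: \<gamma>_def)
      \<comment> \<open>The private matrices give the full constant \<open>n\<close>. It is weakened
        to \<open>n * \<gamma>\<close>, using \<open>\<gamma> \<le> 1\<close>, so that the squares
        of cosine and sine recombine to 1.\<close>
      moreover have "n * \<gamma> * (\<Sum>i\<in>{1..m}. (sin (\<tau> i) * \<xi> (i, r))\<^sup>2)
          \<le> (\<Sum>i'\<in>{1..m}. \<Sum>j<n. (\<Sum>i\<in>{1..m}. B i i' * \<xi> (i, r) * \<sigma> i j)\<^sup>2)"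
        unfolding sum_distrib_left
      proof (rule sum_mono)
        fix i' assume i': "i' \<in> {1..m}"
        have "(\<Sum>i\<in>{1..m}. B i i' * \<xi> (i, r) * \<sigma> i j) = sin (\<tau> i') * \<xi> (i', r) * \<sigma> i' j" for j
        proof -
          have "(\<Sum>i\<in>{1..m}. B i i' * \<xi> (i, r) * \<sigma> i j) =
              (\<Sum>i\<in>{1..m}. if i' = i then sin (\<tau> i) * \<xi> (i, r) * \<sigma> i j else 0)"
            using i' by (intro sum.cong refl) (auto simp: B_def)
          then show ?thesis
            using i' by simp
        qed
        moreover have "(\<Sum>j<n. (sin (\<tau> i') * \<xi> (i', r) * \<sigma> i' j)\<^sup>2) = n * (sin (\<tau> i') * \<xi> (i', r))\<^sup>2"
          using cube_square[OF cube[OF i']] by (simp add: power_mult_distrib flip: power2_eq_square)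
        moreover have "\<gamma> * (n * (sin (\<tau> i') * \<xi> (i', r))\<^sup>2) \<le> 1 * (n * (sin (\<tau> i') * \<xi> (i', r))\<^sup>2)"
        proof (rule mult_right_mono)
          have "0 \<le> m * \<eta>"
            using assms by simp
          then show "\<gamma> \<le> 1"
            unfolding \<gamma>_def using \<open>0 \<le> \<beta>\<close> by linarith
        qed simp
        ultimately show "n * \<gamma> * (sin (\<tau> i') * \<xi> (i', r))\<^sup>2
            \<le> (\<Sum>j<n. (\<Sum>i\<in>{1..m}. B i i' * \<xi> (i, r) * \<sigma> i j)\<^sup>2)"
          by (simp add: mult_ac)
      qed
      moreover have "(\<Sum>i\<in>{1..m}. (\<xi> (i, r))\<^sup>2) =
          (\<Sum>i\<in>{1..m}. (cos (\<tau> i) * \<xi> (i, r))\<^sup>2) + (\<Sum>i\<in>{1..m}. (sin (\<tau> i) * \<xi> (i, r))\<^sup>2)"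
        by (simp add: power_mult_distrib flip: sum.distrib distrib_right)
      ultimately show ?thesis
        unfolding atMost by (simp add: distrib_left B_def)
    qed
    have "n * \<gamma> * (\<Sum>l\<in>?L. (\<xi> l)\<^sup>2) = (\<Sum>r<M. n * \<gamma> * (\<Sum>i\<in>{1..m}. (\<xi> (i, r))\<^sup>2))"
      unfolding sum.cartesian_product' sum_distrib_left by (subst sum.swap) (rule refl)
    also have "\<dots> \<le> (\<Sum>r<M. \<Sum>i'\<le>m. \<Sum>j<n. (\<Sum>i\<in>{1..m}. B i i' * \<xi> (i, r) * \<sigma> i j)\<^sup>2)"
      by (intro sum_mono slice)
    also have "\<dots> = (\<Sum>i'\<le>m. \<Sum>r<M. \<Sum>j<n. (\<Sum>i\<in>{1..m}. B i i' * \<xi> (i, r) * \<sigma> i j)\<^sup>2)"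
      by (rule sum.swap)
    also have "\<dots> = (\<Sum>k\<in>?K. (\<Sum>l\<in>?L. A l k * \<xi> l)\<^sup>2)"
      unfolding sum.cartesian_product'[of _ "{..m}"] sum.cartesian_product'[of _ "{..<M}" "{..<n}"]
      by (intro sum.cong refl) (subst entry, auto)
    finally show ?thesis .
  qed
  have b: "0 < \<kappa> * sqrt n"
    using assms by simp
  have "{\<omega> \<in> space (gaussian_matrices m M n).
        \<forall>i\<in>{1..m}. linf_norm M (mat_vec n (interp_matrix \<omega> i (\<tau> i)) (\<sigma> i)) \<le> \<kappa> * sqrt n} =
      {\<omega> \<in> space (Pi\<^sub>M ?K (\<lambda>_. std_gaussian)). \<forall>l\<in>?L. \<bar>\<Sum>k\<in>?K. A l k * \<omega> k\<bar> \<le> \<kappa> * sqrt n}"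
    using b by (auto simp: gaussian_matrices_def linf_norm_le_iff row simp del: zero_less_mult_iff)
  then have "measure (gaussian_matrices m M n) {\<omega> \<in> space (gaussian_matrices m M n).
      \<forall>i\<in>{1..m}. linf_norm M (mat_vec n (interp_matrix \<omega> i (\<tau> i)) (\<sigma> i)) \<le> \<kappa> * sqrt n}
    \<le> sqrt (exp 1 / (1 + (n * \<gamma>) / (\<kappa> * sqrt n)\<^sup>2)) ^ card ?L"
    using gaussian_small_ball[of ?K ?L "n * \<gamma>" "\<kappa> * sqrt n" A] coercive b assms
    by (simp add: gaussian_matrices_def \<gamma>_def)
  \<comment> \<open>The dimension cancels: \<open>n * \<gamma>\<close> is divided by the square of
    \<open>\<kappa> * sqrt n\<close>.\<close>
  then show ?thesis
    using assms by (simp add: power_mult_distrib \<gamma>_def card_cartesian_product)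
qed

text \<open>Union bound. The first two factors count the tuples of vectors, the third counts the
  assignments of angles, and the last bounds the probability for each fixed choice.\<close>

lemma measure_ogp_set_nonempty_le:
  fixes I :: "real set"
  assumes "0 < n" "1 \<le> m" "0 < \<kappa>" "0 \<le> \<beta>" "0 \<le> \<eta>" "0 \<le> 1 - \<beta> - m * \<eta>" "0 \<le> t" "finite I"
  shows "measure (gaussian_matrices m (num_rows \<alpha> n) n)
      {\<omega> \<in> space (gaussian_matrices m (num_rows \<alpha> n) n). ogp_set \<kappa> \<beta> \<eta> m \<alpha> I n \<omega> \<noteq> {}}
    \<le> 2 ^ n * exp (n * (t * (1 - \<beta> + \<eta>) + exp (- 2 * t))) ^ m * real (card I) ^ m
      * sqrt (exp 1 / (1 + (1 - \<beta> - m * \<eta>) / \<kappa>\<^sup>2)) ^ (m * num_rows \<alpha> n)"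
proof -
  let ?M = "num_rows \<alpha> n"
  let ?P = "gaussian_matrices m ?M n"
  let ?T = "overlap_tuples n m \<beta> \<eta>" and ?J = "{1..m} \<rightarrow>\<^sub>E I"
  let ?E = "\<lambda>(\<sigma>, \<tau>). {\<omega> \<in> space ?P.
      \<forall>i\<in>{1..m}. linf_norm ?M (mat_vec n (interp_matrix \<omega> i (\<tau> i)) (\<sigma> i)) \<le> \<kappa> * sqrt n}"
  let ?q = "sqrt (exp 1 / (1 + (1 - \<beta> - m * \<eta>) / \<kappa>\<^sup>2)) ^ (m * ?M)"
  interpret P: prob_space ?P
    unfolding gaussian_matrices_def by (intro prob_space_PiM prob_space_std_gaussian)
  have fin: "finite (?T \<times> ?J)"
    using assms by (intro finite_cartesian_product finite_PiE) auto
  have entry: "(\<lambda>\<omega>. \<omega> (i, r, j)) \<in> borel_measurable ?P" if "i \<le> m" "r < ?M" "j < n" for i r j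
  proof -
    have "(\<lambda>\<omega>. \<omega> (i, r, j)) \<in> measurable ?P std_gaussian"
      unfolding gaussian_matrices_def using that by (intro measurable_component_singleton) auto
    then show ?thesis
      by (simp cong: measurable_cong_sets)
  qed
  have meas: "?E p \<in> sets ?P" for p
  proof (cases p)
    case (Pair \<sigma> \<tau>)
    have "{\<omega> \<in> space ?P. \<forall>i\<in>{1..m}. \<forall>r\<in>{..<?M}.
        \<bar>\<Sum>j<n. (cos (\<tau> i) * \<omega> (0, r, j) + sin (\<tau> i) * \<omega> (i, r, j)) * \<sigma> i j\<bar> \<le> \<kappa> * sqrt n} \<in> sets ?P"
      by (intro sets.sets_Collect_finite_All borel_measurable_le borel_measurable_abs
          borel_measurable_sum borel_measurable_times borel_measurable_add borel_measurable_const entry) auto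
    also have "{\<omega> \<in> space ?P. \<forall>i\<in>{1..m}. \<forall>r\<in>{..<?M}.
        \<bar>\<Sum>j<n. (cos (\<tau> i) * \<omega> (0, r, j) + sin (\<tau> i) * \<omega> (i, r, j)) * \<sigma> i j\<bar> \<le> \<kappa> * sqrt n} = ?E p"
      using assms by (simp add: Pair linf_norm_le_iff mat_vec_def interp_matrix_def Ball_def)
    finally show ?thesis .
  qed
  have "{\<omega> \<in> space ?P. ogp_set \<kappa> \<beta> \<eta> m \<alpha> I n \<omega> \<noteq> {}} \<subseteq> (\<Union>p\<in>?T \<times> ?J. ?E p)"
  proof
    fix \<omega> assume \<omega>: "\<omega> \<in> {\<omega> \<in> space ?P. ogp_set \<kappa> \<beta> \<eta> m \<alpha> I n \<omega> \<noteq> {}}"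
    then obtain \<sigma> \<tau> where "\<sigma> \<in> ?T" and \<tau>: "\<forall>i\<in>{1..m}. \<tau> i \<in> I \<and>
        linf_norm ?M (mat_vec n (interp_matrix \<omega> i (\<tau> i)) (\<sigma> i)) \<le> \<kappa> * sqrt n"
      unfolding ogp_set_def overlap_tuples_def by blast
    \<comment> \<open>Restriction makes the angle choice extensional, hence a member of the finite
      index set \<open>?J\<close>.\<close>
    moreover have "restrict \<tau> {1..m} \<in> ?J"
      using \<tau> by auto
    ultimately show "\<omega> \<in> (\<Union>p\<in>?T \<times> ?J. ?E p)"
      using \<omega> by (intro UN_I[of "(\<sigma>, restrict \<tau> {1..m})"]) auto
  qed
  then have "measure ?P {\<omega> \<in> space ?P. ogp_set \<kappa> \<beta> \<eta> m \<alpha> I n \<omega> \<noteq> {}}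
      \<le> measure ?P (\<Union>p\<in>?T \<times> ?J. ?E p)"
    using meas fin by (intro P.finite_measure_mono sets.finite_UN) auto
  also have "\<dots> \<le> (\<Sum>p\<in>?T \<times> ?J. measure ?P (?E p))"
    using meas fin by (intro P.finite_measure_subadditive_finite) auto
  also have "\<dots> \<le> (\<Sum>p\<in>?T \<times> ?J. ?q)"
  proof (rule sum_mono)
    fix p assume "p \<in> ?T \<times> ?J"
    then show "measure ?P (?E p) \<le> ?q"
      using measure_tuple_le[where \<sigma> = "fst p" and \<tau> = "snd p" and M = ?M] assms
      by (simp only: mem_Times_iff prod.case_eq_if)
  qed
  also have "\<dots> = real (card ?T) * real (card I) ^ m * ?q"
    by (simp add: card_cartesian_product card_PiE)
  also have "\<dots> \<le> 2 ^ n * exp (n * (t * (1 - \<beta> + \<eta>) + exp (- 2 * t))) ^ m * real (card I) ^ m * ?q"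
  proof -
    have "0 \<le> m * \<eta>"
      using assms by simp
    then have "\<beta> - \<eta> \<le> 1"
      using \<open>0 \<le> \<eta>\<close> \<open>0 \<le> 1 - \<beta> - m * \<eta>\<close> by linarith
    then show ?thesis
      using assms by (intro mult_right_mono card_overlap_tuples) auto
  qed
  finally show ?thesis .
qed

section \<open>Choice of constants for small \<open>\<kappa>\<close>\<close>

text \<open>The value \<open>59 / 10\<close> is \<open>1 + 49 / 10\<close>, the denominator in the
  small-ball bound for the parameters chosen below. Tenth powers and \<open>exp 1 < 2.72\<close>
  reduce the claim to rational arithmetic.\<close>

lemma ln_ratio_ge: "11 / 10 * ln 2 \<le> ln (59 / 10 / exp 1 :: real)"
proof -
  have "(2::real) ^ 11 \<le> (59 / 10 / (272 / 100)) ^ 10"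
    by (simp add: power_divide)
  also have "\<dots> \<le> (59 / 10 / exp 1) ^ 10"
    using e_less_272 by (intro power_mono divide_left_mono) auto
  finally have "ln ((2::real) ^ 11) \<le> ln ((59 / 10 / exp 1) ^ 10)"
    by (intro ln_mono) auto
  moreover have "ln ((2::real) ^ 11) = 11 * ln 2"
      and "ln ((59 / 10 / exp 1 :: real) ^ 10) = 10 * ln (59 / 10 / exp 1)"
    by (subst ln_realpow; simp)+
  ultimately show ?thesis
    by linarith
qed

text \<open>With \<open>1 - \<beta> = 5 * \<kappa>\<^sup>2\<close> and \<open>m * \<eta> = \<kappa>\<^sup>2 / 10\<close>, each of the \<open>m\<close> vectors contributes
  about \<open>5.1 * \<kappa>\<^sup>2 * ln (1 / \<kappa>)\<close> to the entropy, while its constraint costs at least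
  \<open>5.5 * \<kappa>\<^sup>2 * ln (1 / \<kappa>)\<close>.\<close>

lemma ogp_small_kappa:
  assumes "0 < \<kappa>" "\<kappa> \<le> exp (- 10)" and \<alpha>: "alpha_OGP \<kappa> \<le> \<alpha>"
  shows "\<exists>(\<eta>::real) (\<beta>::real) (c::real) (m::nat).
          0 < \<eta> \<and> \<eta> < \<beta> \<and> \<beta> < 1 \<and> c > 0 \<and>
          (\<exists>(c'::real) (n\<^sub>0::nat). c' > 0 \<and>
             (\<forall>n\<ge>n\<^sub>0. \<forall>I \<subseteq> {0..pi / 2}. finite I \<and> real (card I) \<le> 2 powr (c * real n) \<longrightarrow>
                measure (gaussian_matrices m (num_rows \<alpha> n) n)
                  {\<omega> \<in> space (gaussian_matrices m (num_rows \<alpha> n) n).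
                     ogp_set \<kappa> \<beta> \<eta> m \<alpha> I n \<omega> \<noteq> {}}
                  \<le> 2 powr (- c' * real n)))"
proof -
  \<comment> \<open>\<open>H\<close> is the unit in which entropy and cost are compared; each row of
    each vector's constraint contributes a factor \<open>exp (- R / 2)\<close>.\<close>
  define H where "H = \<kappa>\<^sup>2 * ln (1 / \<kappa>)"
  define R where "R = ln (59 / 10 / exp 1 :: real)"
  have ln2: "0 < ln (2::real)"
    by simp
  have L: "10 \<le> ln (1 / \<kappa>)"
    using assms ln_mono[of \<kappa> "exp (- 10)"] by (simp add: ln_div)
  have \<kappa>2: "\<kappa>\<^sup>2 \<le> H / 10"
    using mult_left_mono[OF L, of "\<kappa>\<^sup>2"] by (simp add: H_def)
  have H: "0 < H"
    unfolding H_def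
  proof (rule mult_pos_pos)
    show "0 < ln (1 / \<kappa>)"
      using L by linarith
  qed (use assms in simp)
  \<comment> \<open>This puts \<open>\<beta>\<close> above \<open>1 / 2\<close>, and in particular
    above \<open>\<eta>\<close>.\<close>
  have \<kappa>_small: "\<kappa>\<^sup>2 < 1 / 10"
  proof -
    have "exp (- 10 :: real) \<le> 1 / 11"
      using exp_ge_add_one_self[of 10] by (simp add: exp_minus field_simps)
    then have "\<kappa> \<le> 1 / 11"
      using assms by simp
    then have "\<kappa>\<^sup>2 \<le> (1 / 11)\<^sup>2"
      using assms by (intro power_mono) auto
    then show ?thesis
      by (simp add: power2_eq_square)
  qed
  have R: "11 / 10 * ln 2 \<le> R"
    unfolding R_def by (rule ln_ratio_ge)
  \<comment> \<open>Large \<open>m\<close> spreads the entropy \<open>n * ln 2\<close> of the free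
    first vector over all \<open>m\<close> vectors, at most \<open>n * H / 20\<close> each.\<close>
  obtain m :: nat where m: "20 * ln 2 / H < m"
    using reals_Archimedean2 by blast
  \<comment> \<open>Large \<open>n\<close> absorbs the rounding in \<open>num_rows\<close>: the lost
    row costs \<open>R / 2\<close>, at most \<open>n * H / 20\<close>.\<close>
  obtain n0 :: nat where n0: "10 * R / H < n0"
    using reals_Archimedean2 by blast
  have m1: "1 \<le> m"
  proof -
    have "0 < 20 * ln 2 / H"
      using H by simp
    then have "0 < real m"
      using m by linarith
    then show ?thesis
      by simp
  qed
  have mH: "ln 2 \<le> m * H / 20"
    using m H by (simp add: field_simps)
  define \<eta> where "\<eta> = \<kappa>\<^sup>2 / (10 * m)"
  define \<beta> where "\<beta> = 1 - 5 * \<kappa>\<^sup>2"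
  \<comment> \<open>With this \<open>c\<close>, the choice of one angle costs at most a factor
    \<open>exp (n * H / 10)\<close>.\<close>
  define c where "c = H / (10 * ln 2)"
  define c' where "c' = H / (100 * ln 2)"
  have \<eta>: "0 < \<eta>" "\<eta> \<le> \<kappa>\<^sup>2 / 10" "m * \<eta> = \<kappa>\<^sup>2 / 10"
    using assms m1 by (auto simp: \<eta>_def field_simps)
  have ratio: "exp 1 / (1 + (1 - \<beta> - m * \<eta>) / \<kappa>\<^sup>2) = exp (- R)"
  proof -
    have *: "(1 - \<beta> - m * \<eta>) / \<kappa>\<^sup>2 = 49 / 10"
      using assms \<eta> by (simp add: \<beta>_def field_simps)
    show ?thesis
      unfolding * by (simp add: R_def exp_minus)
  qed
  \<comment> \<open>The coefficient 10 in \<open>alpha_OGP\<close> enters here: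
    \<open>10 * H / ln 2\<close> times \<open>11 / 10 * ln 2\<close> is \<open>11 * H\<close>, and
    the square root halves it to 5.5.\<close>
  have alpha: "11 * H \<le> \<alpha> * R"
  proof -
    have "alpha_OGP \<kappa> = 10 * H / ln 2"
      by (simp add: alpha_OGP_def H_def log_def)
    then have "alpha_OGP \<kappa> * (11 / 10 * ln 2) = 11 * H" and "0 < alpha_OGP \<kappa>"
      using H by simp_all
    then show ?thesis
      using mult_mono[OF \<alpha> R] \<alpha> by simp
  qed
  have bound: "measure (gaussian_matrices m (num_rows \<alpha> n) n)
      {\<omega> \<in> space (gaussian_matrices m (num_rows \<alpha> n) n). ogp_set \<kappa> \<beta> \<eta> m \<alpha> I n \<omega> \<noteq> {}}
    \<le> 2 powr (- c' * real n)"
    if n: "max n0 1 \<le> n" and I: "finite I" "real (card I) \<le> 2 powr (c * real n)" for n and I :: "real set"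
  proof -
    let ?M = "num_rows \<alpha> n"
    \<comment> \<open>This Chernoff parameter makes \<open>exp (- 2 * t)\<close> equal to
      \<open>\<kappa>\<^sup>2\<close>, at most \<open>H / 10\<close>, while the linear term stays at
      \<open>5.1 * H\<close>.\<close>
    define t where "t = ln (1 / \<kappa>)"
    have "0 \<le> t"
      using L by (simp add: t_def)
    have exp_t: "exp (- 2 * t) = \<kappa>\<^sup>2"
      using assms exp_of_nat_mult[of 2 "ln \<kappa>"] by (simp add: t_def ln_div)
    have entropy: "t * (1 - \<beta> + \<eta>) + exp (- 2 * t) \<le> 52 / 10 * H"
    proof -
      have "t * (1 - \<beta> + \<eta>) \<le> t * (51 / 10 * \<kappa>\<^sup>2)"
        using \<eta> \<open>0 \<le> t\<close> by (intro mult_left_mono) (auto simp: \<beta>_def)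
      also have "\<dots> = 51 / 10 * H"
        by (simp add: H_def t_def)
      finally show ?thesis
        unfolding exp_t using \<kappa>2 by simp
    qed
    have "n * (t * (1 - \<beta> + \<eta>) + exp (- 2 * t)) \<le> n * (52 / 10 * H)"
      by (rule mult_left_mono[OF entropy]) simp
    then have entropy': "exp (n * (t * (1 - \<beta> + \<eta>) + exp (- 2 * t))) \<le> exp (n * (52 / 10 * H))"
      by (simp only: exp_le_cancel_iff)
    have "n0 \<le> n"
      using n by simp
    then have "10 * R / H \<le> n"
      using n0 by linarith
    then have RH: "R / 2 \<le> n * H / 20"
      using H by (simp add: field_simps)
    have rows: "n * \<alpha> - 1 \<le> ?M"
      unfolding num_rows_def by linarith
    have "R * (n * \<alpha> - 1) \<le> R * ?M"
      using rows R ln2 by (intro mult_left_mono) linarith+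
    moreover have "n * (11 * H) \<le> n * (\<alpha> * R)"
      using alpha by (intro mult_left_mono) auto
    ultimately have rows': "n * (55 / 10 * H) - R / 2 \<le> R / 2 * ?M"
      by (simp add: algebra_simps)
    have I': "card I \<le> exp (n * H / 10)"
      using I(2) by (simp add: powr_def c_def mult.commute)
    have sqrt_exp: "sqrt (exp (- R)) = exp (- R / 2)"
      by (rule real_sqrt_unique) (auto simp: power2_eq_square simp flip: exp_add)
    have "measure (gaussian_matrices m ?M n)
        {\<omega> \<in> space (gaussian_matrices m ?M n). ogp_set \<kappa> \<beta> \<eta> m \<alpha> I n \<omega> \<noteq> {}}
      \<le> 2 ^ n * exp (n * (t * (1 - \<beta> + \<eta>) + exp (- 2 * t))) ^ m * real (card I) ^ m
        * sqrt (exp 1 / (1 + (1 - \<beta> - m * \<eta>) / \<kappa>\<^sup>2)) ^ (m * ?M)"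
      using n m1 assms \<eta> \<kappa>_small I \<open>0 \<le> t\<close>
      by (intro measure_ogp_set_nonempty_le) (auto simp: \<beta>_def)
    also have "\<dots> \<le> 2 ^ n * exp (n * (52 / 10 * H)) ^ m * exp (n * H / 10) ^ m * exp (- R / 2) ^ (m * ?M)"
      unfolding ratio sqrt_exp
      by (intro mult_right_mono mult_mono power_mono order_refl I' entropy') auto
    also have "\<dots> = exp (n * ln 2 + m * (n * (53 / 10 * H) - R / 2 * ?M))"
    proof -
      have "(2::real) ^ n = exp (n * ln 2)"
        by (simp add: exp_of_nat_mult)
      then show ?thesis
        by (simp add: algebra_simps flip: exp_add exp_of_nat_mult)
    qed
    also have "\<dots> \<le> exp (- (n * H / 100))"
    proof -
      \<comment> \<open>Per vector, in units of \<open>n * H\<close>: 5.2 from overlap entropy and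
        0.1 from angles, against 5.5 minus 0.05 for rounding, leaves -0.15. The first vector's
        entropy then takes back 0.05.\<close>
      have "n * (53 / 10 * H) - R / 2 * ?M \<le> - (n * H * (15 / 100))"
        using rows' RH by (simp add: algebra_simps)
      then have "m * (n * (53 / 10 * H) - R / 2 * ?M) \<le> m * (- (n * H * (15 / 100)))"
        by (intro mult_left_mono) auto
      moreover have "n * ln 2 \<le> n * (m * H / 20)"
        using mH by (intro mult_left_mono) auto
      moreover have "1 * (n * H) \<le> m * (n * H)"
        using m1 H by (intro mult_right_mono) auto
      moreover have "m * (- (n * H * (15 / 100))) = - (15 / 100) * (m * (n * H))"
          "n * (m * H / 20) = m * (n * H) / 20" "0 \<le> n * H"
        using H by simp_all
      ultimately have "n * ln 2 + m * (n * (53 / 10 * H) - R / 2 * ?M) \<le> - (n * H / 100)"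
        by linarith
      then show ?thesis
        by simp
    qed
    also have "\<dots> = 2 powr (- c' * real n)"
      by (simp add: powr_def c'_def mult.commute)
    finally show ?thesis .
  qed
  have "0 < c" "0 < c'"
    using H by (auto simp: c_def c'_def)
  moreover have "\<eta> < \<beta>" "\<beta> < 1"
    using \<eta> \<kappa>_small assms by (auto simp: \<beta>_def)
  ultimately show ?thesis
    using \<eta>(1) bound by (intro exI[of _ \<eta>] exI[of _ \<beta>] exI[of _ c] exI[of _ m] conjI exI[of _ c'] exI[of _ "max n0 1"] allI impI) auto
qed

theorem theorem2p4:
  "\<forall>\<^sub>F \<kappa> :: real in at_right 0.
     \<forall>\<alpha>. alpha_OGP \<kappa> \<le> \<alpha> \<and> \<alpha> < alpha_c \<kappa> \<longrightarrow>
       (\<exists>(\<eta>::real) (\<beta>::real) (c::real) (m::nat).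
          0 < \<eta> \<and> \<eta> < \<beta> \<and> \<beta> < 1 \<and> c > 0 \<and>
          (\<exists>(c'::real) (n\<^sub>0::nat). c' > 0 \<and>
             (\<forall>n\<ge>n\<^sub>0. \<forall>I \<subseteq> {0..pi / 2}. finite I \<and> real (card I) \<le> 2 powr (c * real n) \<longrightarrow>
                measure (gaussian_matrices m (num_rows \<alpha> n) n)
                  {\<omega> \<in> space (gaussian_matrices m (num_rows \<alpha> n) n).
                     ogp_set \<kappa> \<beta> \<eta> m \<alpha> I n \<omega> \<noteq> {}}
                  \<le> 2 powr (- c' * real n))))"
proof -
  \<comment> \<open>The threshold \<open>exp (- 10)\<close> gives
    \<open>ln (1 / \<kappa>) \<ge> 10\<close>, which makes \<open>\<kappa>\<^sup>2\<close> small
    against \<open>H\<close>.\<close>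
  have "\<forall>\<^sub>F \<kappa> :: real in at_right 0. 0 < \<kappa> \<and> \<kappa> \<le> exp (- 10)"
    unfolding eventually_at_right_field by (intro exI[of _ "exp (- 10)"]) auto
  then show ?thesis
    by eventually_elim (use ogp_small_kappa in blast)
qed

end
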